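(* Let $A=\{a_{ij}\}_{i,j=0,1,2,\ldots}$ be a double sequence of complex constants that defines a regular method of summability, and let $g(z)=\sum_{i=0}^{\infty} g_i z^i$ be a complex power series. Then for any complex number $z$ for which the sequence $\{g_i z^i\}_{i\ge 0}$ is convergent, the following two conditions are equivalent: (i) $\lim_{i\to\infty} g_i z^i = 1$; (ii) the double sequence $P_{A;g}(z)=\{a_{ij}\,g_{i+j}\,z^{i+j}\}_{i,j=0,1,2,\ldots}$ defines a regular method of summability.
   Context: Let $c$ be the space of all convergent sequences of complex scalars. A double sequence $B=\{b_{ij}\}_{i,j=0,1,2,\ldots}$ of complex constants is said to define a regular method of summability if the formula $T[s_0,s_1,\ldots]=[t_0,t_1,\ldots]$, with $t_i=\sum_{j=0}^{\infty} b_{ij}s_j$ for $i=0,1,2,\ldots$, defines a linear transformation $T$ of $c$ into itself (in particular all the series converge for every $[s_j]\in c$) which preserves limits, i.e. $\lim_{i\to\infty}t_i=\lim_{i\to\infty}s_i$ for every $[s_i]\in c$. The convention $z^0=1$ is used for all $z$, including $z=0$. The double sequence $P_{A;g}(z)$ is called the power double sequence of second type induced by $A$ and associated with $g$. *)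

theory Defs
  imports Complex_Main "HOL-Computational_Algebra.Formal_Power_Series"
begin

definition convergent_seqs :: "(nat \<Rightarrow> complex) set" where
  "convergent_seqs = {s. convergent s}"

definition matrix_transform :: "(nat \<Rightarrow> nat \<Rightarrow> complex) \<Rightarrow> (nat \<Rightarrow> complex) \<Rightarrow> nat \<Rightarrow> complex" where
  "matrix_transform B s i = (\<Sum>j. B i j * s j)"

text \<open>
  Linearity of the transformation on convergent sequences is not a separate clause: it follows
  from summability, see the two lemmas below the definition. Summability must be required
  explicitly, since \<^const>\<open>suminf\<close> is total.
\<close>

definition regular_method :: "(nat \<Rightarrow> nat \<Rightarrow> complex) \<Rightarrow> bool" where
  "regular_method B \<longleftrightarrow>
     (\<forall>s \<in> convergent_seqs. \<forall>i. summable (\<lambda>j. B i j * s j)) \<and>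
     (\<forall>s \<in> convergent_seqs. matrix_transform B s \<in> convergent_seqs) \<and>
     (\<forall>s \<in> convergent_seqs. lim (matrix_transform B s) = lim s)"

lemma regular_method_transform_add:
  assumes "regular_method B" "s \<in> convergent_seqs" "t \<in> convergent_seqs"
  shows "matrix_transform B (\<lambda>j. s j + t j) =
           (\<lambda>i. matrix_transform B s i + matrix_transform B t i)"
  using assms
  by (auto simp: regular_method_def matrix_transform_def distrib_left suminf_add)

lemma regular_method_transform_scale:
  assumes "regular_method B" "s \<in> convergent_seqs"
  shows "matrix_transform B (\<lambda>j. c * s j) = (\<lambda>i. c * matrix_transform B s i)"
  using assms
  by (auto simp: regular_method_def matrix_transform_def mult.left_commute[of _ c] suminf_mult)

definition power_double_seq2 ::
    "(nat \<Rightarrow> nat \<Rightarrow> complex) \<Rightarrow> complex fps \<Rightarrow> complex \<Rightarrow> nat \<Rightarrow> nat \<Rightarrow> complex" where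
  "power_double_seq2 A g z i j = A i j * fps_nth g (i + j) * z ^ (i + j)"

end

theory Submission
  imports Defs "HOL-Analysis.Uniform_Limit"
begin

text \<open>
  Put \<open>w\<^sub>k = g\<^sub>k z\<^sup>k\<close> and let \<open>L\<close> be its limit. Writing \<open>w\<^sub>k = L + e\<^sub>k\<close>, the transform of a
  convergent sequence \<open>s\<close> under the weighted matrix splits as
  \<open>\<Sum>\<^sub>j a\<^sub>i\<^sub>j w\<^sub>i\<^sub>+\<^sub>j s\<^sub>j = L \<cdot> \<Sum>\<^sub>j a\<^sub>i\<^sub>j s\<^sub>j + \<Sum>\<^sub>j a\<^sub>i\<^sub>j e\<^sub>i\<^sub>+\<^sub>j s\<^sub>j\<close>.
  The first term tends to \<open>L \<cdot> lim s\<close> by regularity. The second is at most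
  \<open>sup\<^sub>j \<bar>s\<^sub>j\<bar> \<cdot> sup {\<bar>e\<^sub>k\<bar> | k \<ge> i} \<cdot> \<Sum>\<^sub>j \<bar>a\<^sub>i\<^sub>j\<bar>\<close>, because the index \<open>i + j\<close> never drops below
  \<open>i\<close>; it vanishes in the limit as soon as the row sums \<open>\<Sum>\<^sub>j \<bar>a\<^sub>i\<^sub>j\<bar>\<close> are bounded uniformly in \<open>i\<close>.
  So the weighted matrix always multiplies limits by \<open>L\<close>
  (\<open>regular_method_shifted_weights\<close>), and it is regular exactly when \<open>L = 1\<close>; the constant
  sequence \<open>1\<close> detects \<open>L\<close>.

  The substance is the boundedness of the row sums (\<open>regular_method_row_sums_bounded\<close>), which is
  the necessity half of the Silverman-Toeplitz theorem. It follows from the uniform boundedness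
  principle for functionals on null sequences given by absolutely summable rows
  (\<open>pointwise_bounded_imp_row_sums_bounded\<close>), used twice: for the truncations of a single row,
  where it yields absolute summability, and then for the family of all rows.
\<close>

section \<open>Uniform boundedness for functionals on null sequences\<close>

text \<open>
  A functional of norm \<open>\<parallel>a\<parallel>\<close> takes values of size about \<open>r \<parallel>a\<parallel>\<close> on every ball of radius \<open>r\<close>,
  wherever its centre \<open>x\<close> lies: if \<open>d\<close> has size \<open>r\<close> and nearly attains the norm, then
  \<open>2 a(d) = a(x + d) - a(x - d)\<close> shows that \<open>x + d\<close> or \<open>x - d\<close> does it. The factor \<open>1/2\<close> pays for
  cutting \<open>d\<close> off after finitely many terms, which keeps it a null sequence.
\<close>

lemma null_perturbation_large_functional:
  fixes a x :: "nat \<Rightarrow> complex" and r :: real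
  assumes a: "summable (\<lambda>j. norm (a j))" and x: "x \<longlonglongrightarrow> 0" and r: "r > 0"
  obtains d where "d \<longlonglongrightarrow> 0" and "\<And>j. norm (d j) \<le> r"
    and "norm (\<Sum>j. a j * (x j + d j)) \<ge> r / 2 * (\<Sum>j. norm (a j))"
proof -
  let ?N = "\<Sum>j. norm (a j)"
  obtain K where K: "(\<Sum>j<K. norm (a j)) \<ge> ?N / 2"
  proof (cases "?N = 0")
    case True
    then show ?thesis using that[of 0] by simp
  next
    case False
    then have "?N / 2 < ?N"
      using suminf_nonneg[OF a] by force
    then have "eventually (\<lambda>K. ?N / 2 < (\<Sum>j<K. norm (a j))) sequentially"
      by (rule order_tendstoD(1)[OF summable_LIMSEQ[OF a]])
    then show ?thesis using that by (auto simp: eventually_sequentially intro: less_imp_le)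
  qed
  define d where "d j = (if j < K then of_real r * cnj (sgn (a j)) else 0)" for j
  have d_lim: "d \<longlonglongrightarrow> 0"
    by (rule tendsto_eventually) (auto simp: d_def eventually_sequentially intro: exI[of _ K])
  have d_le: "norm (d j) \<le> r" for j
    using r by (auto simp: d_def norm_mult norm_sgn)
  have "a j * cnj (sgn (a j)) = of_real (norm (a j))" for j
    by (cases "a j = 0")
      (auto simp: sgn_eq complex_norm_square[symmetric] power2_eq_square)
  then have ad: "a j * d j = (if j < K then of_real (r * norm (a j)) else 0)" for j
    by (auto simp: d_def mult.left_commute)
  have sum_ad: "(\<lambda>j. a j * d j) sums of_real (r * (\<Sum>j<K. norm (a j)))"
    using sums_finite[of "{..<K}" "\<lambda>j. a j * d j"] by (simp add: ad sum_distrib_left)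
  have "Bseq x" using x by (simp add: convergent_imp_Bseq convergentI)
  then obtain C where C: "\<And>j. norm (x j) \<le> C" by (auto simp: Bseq_def)
  have sum_ax: "summable (\<lambda>j. a j * x j)"
    by (rule summable_comparison_test'[OF summable_mult2[OF a, of C], of 0])
      (auto simp: norm_mult intro!: mult_left_mono C)
  define p where "p = (\<Sum>j. a j * x j)"
  define q where "q = (\<Sum>j. a j * d j)"
  have q: "norm q \<ge> r / 2 * ?N"
  proof -
    have "norm q = r * (\<Sum>j<K. norm (a j))"
      using r by (simp add: q_def sums_unique[OF sum_ad, symmetric] sum_nonneg norm_mult
          del: of_real_sum)
    then show ?thesis using K r by simp
  qed
  have plus: "(\<Sum>j. a j * (x j + d j)) = p + q"
    using suminf_add[OF sum_ax sums_summable[OF sum_ad]]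
    by (simp add: p_def q_def distrib_left)
  have minus: "(\<Sum>j. a j * (x j + - d j)) = p - q"
    using suminf_diff[OF sum_ax sums_summable[OF sum_ad]]
    by (simp add: p_def q_def algebra_simps)
  have "2 * norm q \<le> norm (p + q) + norm (p - q)"
    using norm_triangle_ineq4[of "p + q" "p - q"] by (simp add: norm_mult flip: mult_2)
  then consider "norm (p + q) \<ge> norm q" | "norm (p - q) \<ge> norm q" by linarith
  then show ?thesis
  proof cases
    case 1
    then show ?thesis using that[OF d_lim d_le] q plus by simp
  next
    case 2
    then show ?thesis using that[of "\<lambda>j. - d j"] tendsto_minus[OF d_lim] d_le q minus by simp
  qed
qed

text \<open>
  Were the norms unbounded, rows \<open>a (n k)\<close> with norm above \<open>6 \<cdot> 4\<^sup>k \<cdot> k\<close> could be chosen, and the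
  preceding lemma would move a null sequence in steps of size \<open>4\<^sup>-\<^sup>k\<close> so that after step \<open>k\<close> row
  \<open>a (n k)\<close> has a value of at least \<open>4\<^sup>-\<^sup>k/2\<close> times its norm. All later steps together move
  the sequence by at most \<open>4\<^sup>-\<^sup>k/3\<close>, so in the limit a value of at least
  \<open>(1/2 - 1/3) \<cdot> 4\<^sup>-\<^sup>k = 4\<^sup>-\<^sup>k/6\<close> times the norm survives. This exceeds \<open>k\<close>, and the limit sequence
  violates pointwise boundedness.
\<close>

lemma pointwise_bounded_imp_row_sums_bounded:
  fixes a :: "nat \<Rightarrow> nat \<Rightarrow> complex"
  assumes a: "\<And>n. summable (\<lambda>j. norm (a n j))"
    and bounded: "\<And>s. s \<longlonglongrightarrow> 0 \<Longrightarrow> Bseq (\<lambda>n. \<Sum>j. a n j * s j)"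
  shows "\<exists>M. \<forall>n. (\<Sum>j. norm (a n j)) \<le> M"
proof (rule ccontr)
  assume "\<not> ?thesis"
  then have "\<forall>k. \<exists>n. (\<Sum>j. norm (a n j)) > 6 * 4 ^ k * real k"
    by (meson not_le)
  then obtain n where n: "\<And>k. (\<Sum>j. norm (a (n k) j)) > 6 * 4 ^ k * real k"
    by metis
  have "\<exists>f. \<forall>k. f k \<longlonglongrightarrow> 0 \<and> ((\<forall>j. norm (f (Suc k) j - f k j) \<le> (1/4) ^ k) \<and>
      norm (\<Sum>j. a (n k) j * f (Suc k) j) \<ge> (1/4) ^ k / 2 * (\<Sum>j. norm (a (n k) j)))"
  proof (rule dependent_nat_choice)
    show "\<exists>x::nat \<Rightarrow> complex. x \<longlonglongrightarrow> 0" using tendsto_const by blast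
  next
    fix x :: "nat \<Rightarrow> complex" and k assume x: "x \<longlonglongrightarrow> 0"
    obtain d where "d \<longlonglongrightarrow> 0" "\<And>j. norm (d j) \<le> (1/4) ^ k"
      "norm (\<Sum>j. a (n k) j * (x j + d j)) \<ge> (1/4) ^ k / 2 * (\<Sum>j. norm (a (n k) j))"
      using null_perturbation_large_functional[OF a x, of "(1/4) ^ k"] by auto
    then show "\<exists>y. y \<longlonglongrightarrow> 0 \<and> ((\<forall>j. norm (y j - x j) \<le> (1/4) ^ k) \<and>
        norm (\<Sum>j. a (n k) j * y j) \<ge> (1/4) ^ k / 2 * (\<Sum>j. norm (a (n k) j)))"
      using tendsto_add_zero[OF x] by (intro exI[of _ "\<lambda>j. x j + d j"]) auto
  qed
  then obtain f where f0: "\<And>k. f k \<longlonglongrightarrow> 0"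
    and step: "\<And>k j. norm (f (Suc k) j - f k j) \<le> (1/4) ^ k"
    and large: "\<And>k. norm (\<Sum>j. a (n k) j * f (Suc k) j)
      \<ge> (1/4) ^ k / 2 * (\<Sum>j. norm (a (n k) j))"
    by blast
  have geo: "(\<lambda>m. (1/4::real) ^ (m + k)) sums (4/3 * (1/4) ^ k)" for k
    using sums_mult2[OF geometric_sums[of "1/4::real"], of "(1/4) ^ k"] by (simp add: power_add)
  have tail: "summable (\<lambda>m. f (Suc (m + k)) j - f (m + k) j)"
      "norm (\<Sum>m. f (Suc (m + k)) j - f (m + k) j) \<le> 4/3 * (1/4) ^ k" for k j
  proof -
    show "summable (\<lambda>m. f (Suc (m + k)) j - f (m + k) j)"
      by (rule summable_comparison_test'[OF sums_summable[OF geo[of k]], of 0]) (rule step)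
    show "norm (\<Sum>m. f (Suc (m + k)) j - f (m + k) j) \<le> 4/3 * (1/4) ^ k"
      using norm_suminf_le[OF step sums_summable[OF geo]] sums_unique[OF geo[of k]] by simp
  qed
  define s where "s j = f 0 j + (\<Sum>m. f (Suc m) j - f m j)" for j
  have s_diff: "s j - f k j = (\<Sum>m. f (Suc (m + k)) j - f (m + k) j)" for j k
    using suminf_split_initial_segment[OF tail(1)[of 0 j, simplified], of k]
      sum_lessThan_telescope[of "\<lambda>m. f m j" k]
    by (simp add: s_def)
  have close: "norm (s j - f k j) \<le> 4/3 * (1/4) ^ k" for j k
    unfolding s_diff by (rule tail(2))
  \<comment> \<open>The limits over \<open>m\<close> and \<open>j\<close> may be interchanged since the steps are dominated by a
      geometric series; this is what makes the limit a null sequence.\<close>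
  have "(\<lambda>j. \<Sum>m. f (Suc m) j - f m j) \<longlonglongrightarrow> (\<Sum>m. 0)"
    using tannerys_theorem[of "\<lambda>m j. f (Suc m) j - f m j" "\<lambda>_. 0" sequentially "\<lambda>m. (1/4) ^ m"]
      tendsto_diff[OF f0 f0] step summable_geometric[of "1/4::real"]
    by (simp add: case_prod_unfold)
  then have s0: "s \<longlonglongrightarrow> 0"
    using tendsto_add[OF f0[of 0]] unfolding s_def by fastforce
  have "norm (\<Sum>j. a (n k) j * s j) \<ge> real k" for k
  proof -
    let ?N = "\<Sum>j. norm (a (n k) j)"
    have le: "norm (a (n k) j * (s j - f (Suc k) j)) \<le> norm (a (n k) j) * ((1/4) ^ k / 3)" for j
      using mult_left_mono[OF close[of j "Suc k"], of "norm (a (n k) j)"] by (simp add: norm_mult)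
    have sum_diff: "summable (\<lambda>j. a (n k) j * (s j - f (Suc k) j))"
      by (rule summable_comparison_test'[OF summable_mult2[OF a]]) (rule le)
    have diff: "norm (\<Sum>j. a (n k) j * (s j - f (Suc k) j)) \<le> ?N * ((1/4) ^ k / 3)"
      using norm_suminf_le[OF le summable_mult2[OF a]] unfolding suminf_mult2[OF a] .
    have "Bseq (f (Suc k))" by (rule convergent_imp_Bseq[OF convergentI[OF f0]])
    then obtain C where C: "\<And>j. norm (f (Suc k) j) \<le> C" by (auto simp: Bseq_def)
    have sum_f: "summable (\<lambda>j. a (n k) j * f (Suc k) j)"
      by (rule summable_comparison_test'[OF summable_mult2[OF a, of _ C], of 0])
        (auto simp: norm_mult intro!: mult_left_mono C)
    have "(\<Sum>j. a (n k) j * s j) =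
        (\<Sum>j. a (n k) j * f (Suc k) j) + (\<Sum>j. a (n k) j * (s j - f (Suc k) j))"
      using suminf_add[OF sum_f sum_diff] by (simp add: algebra_simps)
    then have "norm (\<Sum>j. a (n k) j * s j) \<ge> (1/4) ^ k / 2 * ?N - ?N * ((1/4) ^ k / 3)"
      using large[of k] diff norm_diff_ineq[of "\<Sum>j. a (n k) j * f (Suc k) j"
          "\<Sum>j. a (n k) j * (s j - f (Suc k) j)"]
      by (simp only:)
    also have "(1/4) ^ k / 2 * ?N - ?N * ((1/4) ^ k / 3) = (1/4) ^ k / 6 * ?N"
      by (simp add: field_simps)
    finally have "(1/4) ^ k / 6 * ?N \<le> norm (\<Sum>j. a (n k) j * s j)" .
    moreover have "real k = (1/4) ^ k / 6 * (6 * 4 ^ k * real k)"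
      by (simp add: power_divide)
    moreover have "\<dots> \<le> (1/4) ^ k / 6 * ?N"
      using n[of k] by (intro mult_left_mono) auto
    ultimately show ?thesis by linarith
  qed
  moreover obtain B where "\<And>m. norm (\<Sum>j. a m j * s j) \<le> B"
    using bounded[OF s0] by (auto simp: Bseq_def)
  moreover obtain k where "real k > B" using reals_Archimedean2 by blast
  ultimately show False by (meson not_le order_trans)
qed

section \<open>Row sums of a regular method\<close>

lemma regular_method_alt:
  "regular_method B \<longleftrightarrow>
     (\<forall>s l. s \<longlonglongrightarrow> l \<longrightarrow> (\<forall>i. summable (\<lambda>j. B i j * s j)) \<and> matrix_transform B s \<longlonglongrightarrow> l)"
proof -
  have "s \<longlonglongrightarrow> l \<longleftrightarrow> convergent s \<and> lim s = l" for s :: "nat \<Rightarrow> complex" and l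
    using convergent_LIMSEQ_iff convergentI limI by blast
  then show ?thesis
    unfolding regular_method_def convergent_seqs_def mem_Collect_eq Ball_def by simp blast
qed

text \<open>
  For a fixed row the partial sums of
  \<open>\<Sum>\<^sub>j a\<^sub>i\<^sub>j s\<^sub>j\<close> converge, hence are bounded for each \<open>s\<close>, and uniform boundedness of the truncated
  rows bounds the partial sums of \<open>\<Sum>\<^sub>j \<bar>a\<^sub>i\<^sub>j\<bar>\<close>. With absolute summability at hand, the whole rows
  form an admissible family, bounded at each \<open>s\<close> because the transform of \<open>s\<close> converges.
\<close>

lemma regular_method_row_sums_bounded:
  assumes "regular_method A"
  obtains M where "\<And>i. summable (\<lambda>j. norm (A i j))" and "\<And>i. (\<Sum>j. norm (A i j)) \<le> M"
proof -
  have summ: "\<And>s i. s \<longlonglongrightarrow> 0 \<Longrightarrow> summable (\<lambda>j. A i j * s j)"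
    and lim: "\<And>s. s \<longlonglongrightarrow> 0 \<Longrightarrow> (\<lambda>i. \<Sum>j. A i j * s j) \<longlonglongrightarrow> 0"
    using assms unfolding regular_method_alt matrix_transform_def by blast+
  have abs_summable: "summable (\<lambda>j. norm (A i j))" for i
  proof -
    define a where "a n j = (if j < n then A i j else 0)" for n j
    have a_sums: "(\<lambda>j. a n j * s j) sums (\<Sum>j<n. A i j * s j)" for n s
      using sums_finite[of "{..<n}" "\<lambda>j. a n j * s j"] by (simp add: a_def)
    have norm_sums: "(\<lambda>j. norm (a n j)) sums (\<Sum>j<n. norm (A i j))" for n
      using sums_finite[of "{..<n}" "\<lambda>j. norm (a n j)"] by (simp add: a_def)
    have "Bseq (\<lambda>n. \<Sum>j. a n j * s j)" if "s \<longlonglongrightarrow> 0" for s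
      using summable_LIMSEQ[OF summ[OF that, of i]] sums_unique[OF a_sums]
      by (simp add: convergent_imp_Bseq convergentI)
    then obtain M where "\<And>n. (\<Sum>j. norm (a n j)) \<le> M"
      using pointwise_bounded_imp_row_sums_bounded[of a] sums_summable[OF norm_sums] by blast
    then show ?thesis
      using sums_unique[OF norm_sums] by (intro summableI_nonneg_bounded[of _ M]) auto
  qed
  moreover have "Bseq (\<lambda>i. \<Sum>j. A i j * s j)" if "s \<longlonglongrightarrow> 0" for s
    using convergent_imp_Bseq[OF convergentI[OF lim[OF that]]] .
  then obtain M where "\<forall>i. (\<Sum>j. norm (A i j)) \<le> M"
    using pointwise_bounded_imp_row_sums_bounded[of A] abs_summable by blast
  ultimately show ?thesis using that by blast
qed

section \<open>Weights depending on the sum of the indices\<close>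

text \<open>
  Row \<open>i\<close> only sees the weights \<open>e\<^sub>k\<close> with \<open>k \<ge> i\<close>, so a null sequence of weights is uniformly small
  along late rows and, against bounded row sums, makes the transform small.
\<close>

lemma shifted_null_weights_transform_tendsto_0:
  fixes A :: "nat \<Rightarrow> nat \<Rightarrow> complex" and e s :: "nat \<Rightarrow> complex"
  assumes A: "\<And>i. summable (\<lambda>j. norm (A i j))" and M: "\<And>i. (\<Sum>j. norm (A i j)) \<le> M"
    and e: "e \<longlonglongrightarrow> 0" and s: "Bseq s"
  shows "summable (\<lambda>j. A i j * e (i + j) * s j)"
    and "(\<lambda>i. \<Sum>j. A i j * e (i + j) * s j) \<longlonglongrightarrow> 0"
proof -
  obtain C where C: "C > 0" "\<And>j. norm (s j) \<le> C" using s by (auto simp: Bseq_def)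
  have M0: "M \<ge> 0" using order_trans[OF suminf_nonneg[OF A] M] by simp
  have bound: "summable (\<lambda>j. A i j * e (i + j) * s j) \<and>
      norm (\<Sum>j. A i j * e (i + j) * s j) \<le> M * (\<epsilon> * C)"
    if \<epsilon>: "\<And>k. k \<ge> i \<Longrightarrow> norm (e k) \<le> \<epsilon>" for i \<epsilon>
  proof -
    have "\<epsilon> \<ge> 0" using order_trans[OF norm_ge_zero \<epsilon>] by blast
    have le: "norm (A i j * e (i + j) * s j) \<le> norm (A i j) * (\<epsilon> * C)" for j
      using \<epsilon>[of "i + j"] C \<open>\<epsilon> \<ge> 0\<close>
      by (auto simp: norm_mult mult.assoc intro!: mult_left_mono mult_mono)
    have "norm (\<Sum>j. A i j * e (i + j) * s j) \<le> (\<Sum>j. norm (A i j)) * (\<epsilon> * C)"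
      using norm_suminf_le[OF le summable_mult2[OF A]] unfolding suminf_mult2[OF A] .
    also have "\<dots> \<le> M * (\<epsilon> * C)"
      using M C(1) \<open>\<epsilon> \<ge> 0\<close> by (intro mult_right_mono) auto
    finally show ?thesis
      using summable_comparison_test'[OF summable_mult2[OF A] le] by blast
  qed
  obtain E where "\<And>k. norm (e k) \<le> E"
    using convergent_imp_Bseq[OF convergentI[OF e]] by (auto simp: Bseq_def)
  then show "summable (\<lambda>j. A i j * e (i + j) * s j)" using bound by blast
  show "(\<lambda>i. \<Sum>j. A i j * e (i + j) * s j) \<longlonglongrightarrow> 0"
  proof (rule LIMSEQ_I)
    fix r :: real assume r: "r > 0"
    \<comment> \<open>\<open>M + 1\<close> instead of \<open>M\<close> keeps the denominator positive when all rows vanish.\<close>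
    define \<epsilon> where "\<epsilon> = r / ((M + 1) * C)"
    have "\<epsilon> > 0" using r C M0 by (simp add: \<epsilon>_def)
    then obtain I where I: "\<And>k. k \<ge> I \<Longrightarrow> norm (e k) < \<epsilon>" using LIMSEQ_D[OF e] by auto
    have "M * (\<epsilon> * C) < (M + 1) * (\<epsilon> * C)"
      using \<open>\<epsilon> > 0\<close> C by (simp add: distrib_right)
    also have "\<dots> = r" using C M0 by (simp add: \<epsilon>_def)
    finally have "norm (\<Sum>j. A i j * e (i + j) * s j) < r" if "i \<ge> I" for i
      using bound[of i \<epsilon>] I that by (meson le_less_trans less_imp_le order_trans)
    then show "\<exists>I. \<forall>i\<ge>I. norm ((\<Sum>j. A i j * e (i + j) * s j) - 0) < r" by auto
  qed
qed

text \<open>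
  The weights are their limit \<open>L\<close> plus a null sequence: the constant part scales a regular
  transform by \<open>L\<close>, and the null part contributes nothing in the limit.
\<close>

lemma regular_method_shifted_weights:
  fixes A :: "nat \<Rightarrow> nat \<Rightarrow> complex" and w s :: "nat \<Rightarrow> complex"
  assumes A: "regular_method A" and w: "w \<longlonglongrightarrow> L" and s: "s \<longlonglongrightarrow> l"
  shows "summable (\<lambda>j. A i j * w (i + j) * s j)"
    and "(\<lambda>i. \<Sum>j. A i j * w (i + j) * s j) \<longlonglongrightarrow> L * l"
proof -
  obtain M where M: "\<And>i. summable (\<lambda>j. norm (A i j))" "\<And>i. (\<Sum>j. norm (A i j)) \<le> M"
    using regular_method_row_sums_bounded[OF A] by blast
  define e where "e k = w k - L" for k
  have e: "e \<longlonglongrightarrow> 0" using w unfolding e_def by (rule LIM_zero)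
  have small: "\<And>i. summable (\<lambda>j. A i j * e (i + j) * s j)"
    "(\<lambda>i. \<Sum>j. A i j * e (i + j) * s j) \<longlonglongrightarrow> 0"
    using shifted_null_weights_transform_tendsto_0 M e convergent_imp_Bseq[OF convergentI[OF s]]
    by blast+
  have main: "\<And>i. summable (\<lambda>j. A i j * s j)" "(\<lambda>i. \<Sum>j. A i j * s j) \<longlonglongrightarrow> l"
    using A s unfolding regular_method_alt matrix_transform_def by blast+
  have split: "A i j * w (i + j) * s j = L * (A i j * s j) + A i j * e (i + j) * s j" for i j
    by (simp add: e_def algebra_simps)
  show "summable (\<lambda>j. A i j * w (i + j) * s j)"
    unfolding split by (intro summable_add summable_mult main small)
  have "(\<Sum>j. A i j * w (i + j) * s j) =
      L * (\<Sum>j. A i j * s j) + (\<Sum>j. A i j * e (i + j) * s j)" for i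
    unfolding split
    using suminf_add[OF summable_mult[OF main(1), of L i] small(1)[of i]]
      suminf_mult[OF main(1), of L i]
    by simp
  then show "(\<lambda>i. \<Sum>j. A i j * w (i + j) * s j) \<longlonglongrightarrow> L * l"
    using tendsto_add[OF tendsto_mult_left[OF main(2), of L] small(2)] by simp
qed

theorem theorem1:
  fixes A :: "nat \<Rightarrow> nat \<Rightarrow> complex" and g :: "complex fps" and z :: complex
  assumes "regular_method A"
    and "convergent (\<lambda>i. fps_nth g i * z ^ i)"
  shows "((\<lambda>i. fps_nth g i * z ^ i) \<longlonglongrightarrow> 1) \<longleftrightarrow>
         regular_method (power_double_seq2 A g z)"
proof -
  define w where "w k = fps_nth g k * z ^ k" for k
  obtain L where w: "w \<longlonglongrightarrow> L"
    using assms(2) unfolding w_def[abs_def] convergent_def by blast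
  have P: "power_double_seq2 A g z i j = A i j * w (i + j)" for i j
    by (simp add: power_double_seq2_def w_def mult.assoc)
  note transform = regular_method_shifted_weights[OF assms(1) w]
  have "w \<longlonglongrightarrow> 1 \<longleftrightarrow> regular_method (power_double_seq2 A g z)"
  proof
    assume "w \<longlonglongrightarrow> 1"
    then have "L = 1" using w LIMSEQ_unique by blast
    then show "regular_method (power_double_seq2 A g z)"
      unfolding regular_method_alt matrix_transform_def[abs_def] P using transform by simp
  next
    assume "regular_method (power_double_seq2 A g z)"
    then have "(\<lambda>i. \<Sum>j. A i j * w (i + j) * 1) \<longlonglongrightarrow> 1"
      unfolding regular_method_alt matrix_transform_def[abs_def] P using tendsto_const by blast
    moreover have "(\<lambda>i. \<Sum>j. A i j * w (i + j) * 1) \<longlonglongrightarrow> L"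
      using transform(2)[OF tendsto_const[of 1]] by simp
    ultimately show "w \<longlonglongrightarrow> 1" using w LIMSEQ_unique by blast
  qed
  then show ?thesis by (simp add: w_def[abs_def])
qed

end
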